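(* Let $\mathcal{P}$ be the set of integer partitions that satisfy Condition($1$) and in which the part $1$ appears at most once. Then, as formal power series in $x,q$, writing $N=i+2j+3k$, $$\sum_{\pi\in\mathcal{P}}x^{\ell(\pi)}q^{|\pi|}=\sum_{i,j,k\ge 0}\frac{x^{N}q^{\frac{N(N-1)}{2}+i+j^2+2j+4k}}{(q;q)_i\,(q^2;q^2)_j\,(q^3;q^3)_k}.$$
   Context: Partitions are finite weakly increasing sequences of positive integers (the empty partition is included); $\ell(\pi)$ is the number of parts and $|\pi|$ the sum of the parts of $\pi$. For a fixed integer $c$, a partition $\pi=\lambda_1+\lambda_2+\cdots+\lambda_m$ with $\lambda_1\le\lambda_2\le\cdots\le\lambda_m$ satisfies Condition($c$) if $\lambda_{s+3}-\lambda_s\ge 3$ for all $1\le s\le m-3$, and, for all $1\le s\le m-2$, if $\lambda_{s+2}-\lambda_s\le 1$ then $\lambda_s+\lambda_{s+1}+\lambda_{s+2}\equiv c\pmod 3$. For $n\ge 0$, $(a;q)_n=\prod_{0\le t<n}(1-aq^t)$. All identities are identities of formal power series. *)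

theory Defs
  imports
    "HOL-Analysis.Infinite_Sum"
    "HOL-Computational_Algebra.Formal_Power_Series"
    "HOL-Number_Theory.Cong"
begin

definition is_partition :: "nat list \<Rightarrow> bool" where
  "is_partition p \<longleftrightarrow> sorted p \<and> (\<forall>a\<in>set p. a > 0)"

definition Condition :: "int \<Rightarrow> nat list \<Rightarrow> bool" where
  "Condition c p \<longleftrightarrow>
     (\<forall>s. s + 3 < length p \<longrightarrow> int (p ! (s + 3)) - int (p ! s) \<ge> 3) \<and>
     (\<forall>s. s + 2 < length p \<longrightarrow> int (p ! (s + 2)) - int (p ! s) \<le> 1 \<longrightarrow>
        [int (p ! s) + int (p ! (s + 1)) + int (p ! (s + 2)) = c] (mod 3))"

definition P_set :: "nat list set" where
  "P_set = {p. is_partition p \<and> Condition 1 p \<and> count_list p 1 \<le> 1}"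

text \<open>
  A power series in \<open>x, q\<close> is a series in \<open>q\<close> whose coefficients are series in \<open>x\<close>. The outer
  variable has to be \<open>q\<close>: the library topology on formal power series treats coefficients as
  discrete, so this is \<open>q\<close>-adic convergence, and each power of \<open>q\<close> receives only finitely many
  contributions on either side of the identity, whereas every positive power of \<open>x\<close>
  receives infinitely many.
\<close>

type_synonym xq_series = "rat fps fps"

definition X :: xq_series where "X = fps_const fps_X"

definition Q :: xq_series where "Q = fps_X"

definition qpoch :: "'a::comm_ring_1 \<Rightarrow> 'a \<Rightarrow> nat \<Rightarrow> 'a" where
  "qpoch a q n = (\<Prod>t<n. 1 - a * q ^ t)"

text \<open>
  Since \<open>xq_series\<close> is not a field, quotients are written with the library's \<open>inverse\<close> on formal
  power series; on the denominators that occur it is the actual multiplicative inverse.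
\<close>

lemma qpoch_mult_inverse:
  assumes "m > 0"
  shows "qpoch (Q ^ m) (Q ^ m) n * inverse (qpoch (Q ^ m) (Q ^ m) n) = 1"
proof -
  have *: "fps_nth (qpoch (Q ^ m) (Q ^ m) n) 0 = 1"
    using assms by (induction n) (auto simp: qpoch_def Q_def)
  then have "inverse (fps_nth (qpoch (Q ^ m) (Q ^ m) n) 0) = 1"
    by (simp add: fps_inverse_one')
  with * show ?thesis
    using fps_right_inverse[of "qpoch (Q ^ m) (Q ^ m) n" 1] by (simp add: fps_inverse_def)
qed

definition lhs_term :: "nat list \<Rightarrow> xq_series" where
  "lhs_term p = X ^ length p * Q ^ sum_list p"

definition rhs_term :: "nat \<Rightarrow> nat \<Rightarrow> nat \<Rightarrow> xq_series" where
  "rhs_term i j k = (let N = i + 2 * j + 3 * k in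
     X ^ N * Q ^ (N * (N - 1) div 2 + i + j ^ 2 + 2 * j + 4 * k) *
     inverse (qpoch Q Q i * qpoch (Q ^ 2) (Q ^ 2) j * qpoch (Q ^ 3) (Q ^ 3) k))"

end

(*
  Condition(1) allows three consecutive parts to span at most 1 only in the pattern a, a, a+1, and
  it is invariant under adding a constant to all parts, since the sum of three parts then changes
  by a multiple of 3. Removing the smallest parts therefore expresses the partitions in question by
  shifted copies of themselves: with P(x) the generating function, this yields
    P(x) - P(xq) = xq P(xq) + x^2 q^4 P(xq^3) + x^3 q^7 P(xq^3) - x^4 q^11 P(xq^4).
  On the other side, dividing the coefficient of x^N by q^(N(N-1)/2) turns the triple sum into
  D(x) = (-x^2 q^3; q^2) / ((xq; q) (x^3 q^4; q^3)) (infinite products), for which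
    (1 - xq) (1 - x^3 q^4) D(x) = (1 + x^2 q^3) D(xq).
  In terms of the coefficients of x^N the two functional equations are the same recurrence, which
  has a unique solution with constant term 1.
*)

theory Submission
  imports Defs
begin

section \<open>Peeling off the smallest parts\<close>

definition above :: "nat \<Rightarrow> nat list set" where
  "above m = {p. sorted p \<and> (\<forall>a\<in>set p. m < a) \<and> Condition 1 p}"

definition above_once :: "nat \<Rightarrow> nat list set" where
  "above_once m = {p \<in> above m. count_list p (Suc m) \<le> 1}"

lemma P_set_eq_above_once: "P_set = above_once 0"
  by (auto simp: P_set_def above_once_def above_def is_partition_def)

lemma Condition_Nil: "Condition c []"
  by (simp add: Condition_def)

text \<open>Only the windows that start at the new head are new. Indices into \<open>p\<close> lag
  by one, so \<open>p ! 2\<close> is the fourth part of \<open>a # p\<close>.\<close>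

lemma Condition_Cons:
  "Condition c (a # p) \<longleftrightarrow> Condition c p \<and> (2 < length p \<longrightarrow> a + 3 \<le> p ! 2) \<and>
     (1 < length p \<longrightarrow> p ! 1 \<le> Suc a \<longrightarrow> [int a + int (p ! 0) + int (p ! 1) = c] (mod 3))"
proof -
  have *: "(\<forall>s. Q s) \<longleftrightarrow> Q 0 \<and> (\<forall>s. Q (Suc s))" for Q :: "nat \<Rightarrow> bool"
    by (metis not0_implies_Suc)
  show ?thesis
    unfolding Condition_def by (subst (1 2) *) (auto simp: numeral_2_eq_2 numeral_3_eq_3)
qed

lemma cong_1_mod_3:
  "[int a + int b + int c = 1] (mod 3) \<longleftrightarrow> (a + b + c) mod 3 = 1"
  using cong_int_iff[of "a + b + c" 1 3] by (simp add: cong_def)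

lemma Condition_shift: "Condition c (map ((+) m) p) \<longleftrightarrow> Condition c p"
proof (induction p)
  case (Cons a p)
  have "[int (m + a) + int (m + b) + int (m + d) = c] (mod 3) \<longleftrightarrow>
        [int a + int b + int d = c] (mod 3)" for b d
  proof -
    have "int (m + a) + int (m + b) + int (m + d) = (int a + int b + int d) + int m * 3"
      by simp
    then show ?thesis by (simp only: cong_def mod_mult_self1)
  qed
  with Cons show ?case by (auto simp only: Condition_Cons list.map length_map nth_map)
qed (simp add: Condition_Nil)

lemma above_shift: "above m = map ((+) m) ` above 0"
proof (intro equalityI subsetI)
  fix p assume p: "p \<in> above m"
  \<comment> \<open>Every part exceeds \<open>m\<close>, so the truncated subtraction loses
    nothing.\<close>
  have eq: "p = map ((+) m) (map (\<lambda>a. a - m) p)"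
    unfolding map_map by (rule map_idI[symmetric]) (use p in \<open>auto simp: above_def\<close>)
  have "sorted (map (\<lambda>a. a - m) p)"
    using p by (auto simp: above_def sorted_map intro: sorted_wrt_mono_rel[of p "(\<le>)"])
  moreover have "Condition 1 (map (\<lambda>a. a - m) p)"
    using p Condition_shift[of 1 m "map (\<lambda>a. a - m) p", folded eq] by (simp add: above_def)
  ultimately have "map (\<lambda>a. a - m) p \<in> above 0"
    using p by (auto simp: above_def)
  with eq show "p \<in> map ((+) m) ` above 0" by blast
qed (auto simp: above_def Condition_shift sorted_map intro: sorted_wrt_mono_rel[of _ "(\<le>)"])

lemma above_once_shift: "above_once m = map ((+) m) ` above_once 0"
proof -
  have "count_list (map ((+) m) p) (Suc m) = count_list p 1" for p
    by (induction p) auto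
  then show ?thesis unfolding above_once_def above_shift[of m] by auto
qed


text \<open>The possible triples are a,a,a and a,a,a+1 and a,a+1,a+1, with sums 3a, 3a+1 and 3a+2.
  This trades the congruence for linear conditions.\<close>

lemma sum_mod_3_iff:
  fixes a b c :: nat
  assumes "a \<le> b" "b \<le> c" "c \<le> Suc a"
  shows "(a + b + c) mod 3 = 1 \<longleftrightarrow> b = a \<and> c = Suc a"
proof -
  consider "b = a" "c = a" | "b = a" "c = Suc a" | "b = Suc a" "c = Suc a"
    using assms by linarith
  then show ?thesis
  proof cases
    case 1
    then have "a + b + c = 3 * a" by simp
    with 1 show ?thesis by (simp only: mod_mult_self1_is_0) simp
  next
    case 2
    then have "a + b + c = 1 + 3 * a" by simp
    with 2 show ?thesis by (simp only: mod_mult_self2) simp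
  next
    case 3
    then have "a + b + c = 2 + 3 * a" by simp
    with 3 show ?thesis by (simp only: mod_mult_self2) simp
  qed
qed

lemma Nil_in_above: "[] \<in> above m"
  by (simp add: above_def Condition_Nil)

text \<open>By sortedness only the next three parts matter for a new head, and the congruence has
  become the pattern a,a,a+1. Membership thus reduces to linear arithmetic on the first few
  parts.\<close>

lemma above_Cons_iff:
  "a # p \<in> above m \<longleftrightarrow> m < a \<and> p \<in> above m \<and> (0 < length p \<longrightarrow> a \<le> p ! 0) \<and>
     (2 < length p \<longrightarrow> a + 3 \<le> p ! 2) \<and>
     (1 < length p \<longrightarrow> p ! 1 \<le> Suc a \<longrightarrow> p ! 0 = a \<and> p ! 1 = Suc a)"
proof -
  have "(\<forall>x\<in>set p. a \<le> x) \<longleftrightarrow> (0 < length p \<longrightarrow> a \<le> p ! 0)" if "sorted p"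
    using that by (cases p) auto
  moreover have "[int a + int (p ! 0) + int (p ! 1) = 1] (mod 3) \<longleftrightarrow> p ! 0 = a \<and> p ! 1 = Suc a"
    if "sorted p" "\<forall>x\<in>set p. a \<le> x" "1 < length p" "p ! 1 \<le> Suc a"
  proof -
    have "p ! 0 \<in> set p" using that by (intro nth_mem) linarith
    then show ?thesis
      using that unfolding cong_1_mod_3 by (intro sum_mod_3_iff) (auto simp: sorted_nth_mono)
  qed
  ultimately show ?thesis
    by (auto simp: above_def Condition_Cons)
qed

lemma above_mono_iff: "n \<le> m \<Longrightarrow> p \<in> above m \<longleftrightarrow> p \<in> above n \<and> (0 < length p \<longrightarrow> m < p ! 0)"
  by (cases p) (force simp: above_def)+

text \<open>These are the facts about a tail that the linear arithmetic below needs; the length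
  guards cover short tails without case splits.\<close>

lemma above_first_three:
  assumes "p \<in> above m"
  shows "1 < length p \<longrightarrow> p ! 0 \<le> p ! 1" "2 < length p \<longrightarrow> p ! 1 \<le> p ! 2"
    and "2 < length p \<longrightarrow> p ! 2 \<le> Suc (p ! 0) \<longrightarrow> p ! 1 = p ! 0 \<and> p ! 2 = Suc (p ! 0)"
proof -
  show "1 < length p \<longrightarrow> p ! 0 \<le> p ! 1" "2 < length p \<longrightarrow> p ! 1 \<le> p ! 2"
    using assms by (simp_all add: above_def sorted_nth_mono)
  show "2 < length p \<longrightarrow> p ! 2 \<le> Suc (p ! 0) \<longrightarrow> p ! 1 = p ! 0 \<and> p ! 2 = Suc (p ! 0)"
  proof (cases p)
    case (Cons a r)
    with assms show ?thesis by (auto simp: above_Cons_iff numeral_2_eq_2)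
  qed simp
qed

text \<open>Since \<open>Suc m\<close> is the least value allowed, a second copy of it in a sorted
  list would stand at index 1.\<close>

lemma above_once_iff: "p \<in> above_once m \<longleftrightarrow> p \<in> above m \<and> (1 < length p \<longrightarrow> Suc m < p ! 1)"
proof -
  have "count_list p (Suc m) \<le> 1 \<longleftrightarrow> (1 < length p \<longrightarrow> Suc m < p ! 1)" if "p \<in> above m"
  proof (cases p rule: remdups_adj.cases)
    case (3 a b r)
    have "count_list r (Suc m) = 0" if "Suc m < b"
      using that \<open>p \<in> above m\<close> 3 by (auto simp: above_def count_list_0_iff)
    with 3 that show ?thesis by (auto simp: above_def)
  qed auto
  then show ?thesis by (auto simp: above_once_def)
qed

text \<open>After a single 1 the part 2 cannot occur twice, since 1,2,2 has span 1 and sum 5.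
  Conversely, the gap of 3 between the 1 and the fourth part is automatic: otherwise the tail would
  start with 2,3,3 or 3,3,3, whose sums 8 and 9 are not 1 modulo 3.\<close>

lemma above_once_0_eq: "above_once 0 = above 1 \<union> (#) 1 ` above_once 1"
proof (rule set_eqI)
  fix p :: "nat list"
  show "p \<in> above_once 0 \<longleftrightarrow> p \<in> above 1 \<union> (#) 1 ` above_once 1"
  proof (cases p)
    case (Cons a r)
    have "1 # r \<in> above_once 0 \<longleftrightarrow> r \<in> above_once 1"
    proof (cases "r \<in> above 0")
      case True
      show ?thesis
        unfolding above_once_iff above_Cons_iff above_mono_iff[of 0 1 r, OF zero_le_one]
        using above_first_three[OF True]
        by (simp add: True numeral_2_eq_2 del: length_greater_0_conv) linarith
    qed (simp add: above_once_iff above_Cons_iff above_mono_iff[of 0 1 r, OF zero_le_one, unfolded One_nat_def])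
    moreover have "a # r \<in> above_once 0 \<longleftrightarrow> a # r \<in> above 1" if "a \<noteq> 1"
      using that
      unfolding above_once_iff above_mono_iff[of 0 1 "a # r", OF zero_le_one]
      by (auto simp: above_Cons_iff[of a r 0])
    moreover have "1 # r \<notin> above 1" by (simp add: above_Cons_iff)
    ultimately show ?thesis using Cons by (cases "a = 1") auto
  qed (simp add: above_once_iff Nil_in_above)
qed

text \<open>The start 1,1,1 has sum 3 and is forbidden, 1,1,2 has sum 4 and is allowed, and the
  fourth part must be at least 4. So either a 2 follows and then only parts above 3, or all further
  parts exceed 2 and 3 occurs at most once.\<close>

lemma Cons_1_1_in_above_iff:
  "1 # 1 # r \<in> above 0 \<longleftrightarrow> r \<in> above_once 2 \<union> (#) 2 ` above 3"
proof (cases "r \<in> above 0")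
  case True
  have "1 # 1 # r \<in> above 0 \<longleftrightarrow> (0 < length r \<longrightarrow> 1 < r ! 0) \<and> (1 < length r \<longrightarrow> 3 < r ! 1)"
    unfolding above_Cons_iff
    using above_first_three[OF True]
    by (simp add: True numeral_2_eq_2 del: length_greater_0_conv) linarith
  also have "\<dots> \<longleftrightarrow> r \<in> above_once 2 \<union> (#) 2 ` above 3"
  proof (cases "0 < length r \<and> r ! 0 = 2")
    case r: True
    then obtain r' where "r = 2 # r'" by (cases r) auto
    with True show ?thesis
      by (auto simp: above_once_iff above_mono_iff[of 0 3] above_mono_iff[of 0 2] above_Cons_iff)
  next
    case False
    with True show ?thesis
      by (auto simp: above_once_iff above_mono_iff[of 0 2])
  qed
  finally show ?thesis .
next
  case False
  \<comment> \<open>The fourth part of \<open>2 # p\<close> has to reach 5. It does, because 4,4,4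
    has sum 12 and cannot start \<open>p\<close>.\<close>
  have "2 # p \<in> above 0" if "p \<in> above 3" for p
  proof -
    have "p \<in> above 0" "0 < length p \<longrightarrow> 3 < p ! 0"
      using that above_mono_iff[of 0 3 p] by simp_all
    then show ?thesis
      unfolding above_Cons_iff using above_first_three[OF that]
      by (simp add: numeral_2_eq_2 del: length_greater_0_conv) linarith
  qed
  then have "r \<notin> (#) 2 ` above 3" using False by blast
  moreover have "r \<notin> above_once 2" using False by (simp add: above_once_iff above_mono_iff[of 0 2])
  moreover have "1 # 1 # r \<notin> above 0" using False by (simp add: above_Cons_iff)
  ultimately show ?thesis by blast
qed

text \<open>The three classes are: at most one 1; 1,1 followed by no 2; and 1,1,2.\<close>

lemma above_0_eq: "above 0 = above_once 0 \<union> ((\<lambda>p. 1 # 1 # p) ` above_once 2 \<union> (\<lambda>p. 1 # 1 # 2 # p) ` above 3)"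
proof -
  have "p \<in> above_once 0 \<or> p \<in> (\<lambda>p. 1 # 1 # p) ` (above_once 2 \<union> (#) 2 ` above 3)" if "p \<in> above 0" for p
  proof (cases "p \<in> above_once 0")
    case False
    with that obtain a b r where "p = a # b # r"
      by (cases p rule: remdups_adj.cases) (auto simp: above_once_iff)
    with that False have "p = 1 # 1 # r" by (auto simp: above_once_iff above_Cons_iff)
    with that show ?thesis using Cons_1_1_in_above_iff by blast
  qed simp
  moreover have "p \<in> above 0" if "p \<in> above_once 0" for p using that by (simp add: above_once_def)
  ultimately have "above 0 = above_once 0 \<union> (\<lambda>p. 1 # 1 # p) ` (above_once 2 \<union> (#) 2 ` above 3)"
    using Cons_1_1_in_above_iff by blast
  then show ?thesis by (simp only: image_Un image_image)
qed

section \<open>Generating functions by length\<close>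

text \<open>The weight \<open>g\<close> bounds the order of each term from below. Hence coefficient
  \<open>n\<close> is the same for all finite partial sums that include the terms of weight at most
  \<open>n\<close>, and convergence of series means exactly that every coefficient is eventually
  constant.\<close>

lemma has_sum_fps:
  fixes f :: "'b \<Rightarrow> 'a::ab_group_add fps"
  assumes fin: "\<And>n. finite {a \<in> A. g a \<le> n}"
    and zero: "\<And>a n. a \<in> A \<Longrightarrow> n < g a \<Longrightarrow> fps_nth (f a) n = 0"
  shows "(f has_sum Abs_fps (\<lambda>n. \<Sum>a | a \<in> A \<and> g a \<le> n. fps_nth (f a) n)) A"
  unfolding has_sum_def
proof (rule tendsto_fpsI)
  fix n
  show "\<forall>\<^sub>F F in finite_subsets_at_top A. fps_nth (sum f F) n =
          fps_nth (Abs_fps (\<lambda>n. \<Sum>a | a \<in> A \<and> g a \<le> n. fps_nth (f a) n)) n"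
    unfolding eventually_finite_subsets_at_top
  proof (intro exI[of _ "{a \<in> A. g a \<le> n}"] conjI allI impI)
    fix F assume F: "finite F \<and> {a \<in> A. g a \<le> n} \<subseteq> F \<and> F \<subseteq> A"
    show "fps_nth (sum f F) n =
            fps_nth (Abs_fps (\<lambda>n. \<Sum>a | a \<in> A \<and> g a \<le> n. fps_nth (f a) n)) n"
      unfolding fps_sum_nth fps_nth_Abs_fps
      by (rule sum.mono_neutral_right) (use F in \<open>auto intro!: zero simp: not_le\<close>)
  qed (use fin in auto)
qed

text \<open>This is the coefficient of x^N in the generating function of \<open>S\<close>. Its
  coefficients are constants in x, but the type \<open>xq_series\<close> allows multiplication by
  \<open>X ^ N\<close>.\<close>

definition length_gf :: "nat list set \<Rightarrow> nat \<Rightarrow> xq_series" where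
  "length_gf S N = Abs_fps (\<lambda>n. of_nat (card {p \<in> S. length p = N \<and> sum_list p = n}))"

lemma finite_lists_length_sum:
  "finite {p \<in> S. length p = N \<and> sum_list p = (n::nat)}"
proof (rule finite_subset)
  show "{p \<in> S. length p = N \<and> sum_list p = n} \<subseteq> {p. set p \<subseteq> {..n} \<and> length p = N}"
    by (auto dest: member_le_sum_list)
qed (simp add: finite_lists_length_eq)

lemma length_gf_Un: "S \<inter> S' = {} \<Longrightarrow> length_gf (S \<union> S') N = length_gf S N + length_gf S' N"
proof (rule fps_ext)
  fix n assume "S \<inter> S' = {}"
  then have "card ({p \<in> S. length p = N \<and> sum_list p = n} \<union> {p \<in> S'. length p = N \<and> sum_list p = n})
      = card {p \<in> S. length p = N \<and> sum_list p = n} + card {p \<in> S'. length p = N \<and> sum_list p = n}"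
    by (intro card_Un_disjoint finite_lists_length_sum) auto
  moreover have "{p \<in> S. length p = N \<and> sum_list p = n} \<union> {p \<in> S'. length p = N \<and> sum_list p = n}
      = {p \<in> S \<union> S'. length p = N \<and> sum_list p = n}" by auto
  ultimately show "fps_nth (length_gf (S \<union> S') N) n = fps_nth (length_gf S N + length_gf S' N) n"
    by (simp add: length_gf_def)
qed

text \<open>The weight \<open>w\<close> is required only on lists of length \<open>N\<close>,
  because adding m to all parts raises the sum by m * N.\<close>

lemma length_gf_image:
  assumes "inj_on h S" "\<And>p. p \<in> S \<Longrightarrow> length (h p) = length p + l"
    and "\<And>p. p \<in> S \<Longrightarrow> length p = N \<Longrightarrow> sum_list (h p) = sum_list p + w"
  shows "length_gf (h ` S) (N + l) = Q ^ w * length_gf S N"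
proof (rule fps_ext)
  fix n
  have "{p \<in> h ` S. length p = N + l \<and> sum_list p = n} =
      (if n < w then {} else h ` {p \<in> S. length p = N \<and> sum_list p = n - w})"
    using assms(2,3) by (auto simp: image_iff)
  then have "card {p \<in> h ` S. length p = N + l \<and> sum_list p = n} =
      (if n < w then 0 else card {p \<in> S. length p = N \<and> sum_list p = n - w})"
    using assms(1) by (auto intro!: card_image inj_on_subset[OF assms(1)])
  then show "fps_nth (length_gf (h ` S) (N + l)) n = fps_nth (Q ^ w * length_gf S N) n"
    by (simp add: length_gf_def Q_def fps_X_power_mult_nth)
qed

lemma length_gf_eq_0: "(\<And>p. p \<in> S \<Longrightarrow> length p \<noteq> N) \<Longrightarrow> length_gf S N = 0"
  by (rule fps_ext) (auto simp: length_gf_def card_eq_0_iff)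

text \<open>The two decompositions are read off length by length: removed parts contribute their
  sum, and a shift by m contributes m per remaining part. So 2 + 2(N-2) = 2N-2 for 1,1 and 4 +
  3(N-3) = 3N-5 for 1,1,2. The conditionals cover lengths too small for the removed prefix.\<close>

lemma length_gf_system:
  shows length_gf_above_once_0: "length_gf (above_once 0) 0 = 1"
    and length_gf_above_once_Suc: "length_gf (above_once 0) (Suc N) = Q ^ Suc N * length_gf (above 0) (Suc N) +
      Q ^ Suc N * length_gf (above_once 0) N"
    and length_gf_above: "length_gf (above 0) N = length_gf (above_once 0) N +
      (if N < 2 then 0 else Q ^ (2 * N - 2) * length_gf (above_once 0) (N - 2)) +
      (if N < 3 then 0 else Q ^ (3 * N - 5) * length_gf (above 0) (N - 3))"
proof -
  have sum_map: "sum_list (map ((+) m) p) = sum_list p + m * length p" for m :: nat and p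
    by (induction p) auto
  have shift: "length_gf (map ((+) m) ` S) N = Q ^ (m * N) * length_gf S N" for m S N
    using length_gf_image[of "map ((+) m)" S 0 N "m * N"] by (simp add: sum_map inj_on_def)
  have shift_once: "length_gf (above_once m) N = Q ^ (m * N) * length_gf (above_once 0) N" for m N
    using shift[of m "above_once 0"] above_once_shift[of m] by simp
  have shift_above: "length_gf (above m) N = Q ^ (m * N) * length_gf (above 0) N" for m N
    using shift[of m "above 0"] above_shift[of m] by simp
  have "{p \<in> above_once 0. length p = 0 \<and> sum_list p = n} = (if n = 0 then {[]} else {})" for n
    using Nil_in_above[of 0] by (auto simp: above_once_iff)
  then show "length_gf (above_once 0) 0 = 1"
    by (intro fps_ext) (simp add: length_gf_def)
  have "length_gf ((#) 1 ` above_once 1) (N + 1) = Q ^ 1 * length_gf (above_once 1) N"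
    by (rule length_gf_image) auto
  moreover have "length_gf (above_once 0) (Suc N) =
      length_gf (above 1) (Suc N) + length_gf ((#) 1 ` above_once 1) (Suc N)"
    by (subst above_once_0_eq, rule length_gf_Un) (auto simp: above_Cons_iff)
  ultimately show "length_gf (above_once 0) (Suc N) = Q ^ Suc N * length_gf (above 0) (Suc N) +
      Q ^ Suc N * length_gf (above_once 0) N"
    by (simp add: shift_above[of 1, simplified] shift_once[of 1, simplified] mult.assoc)
  let ?A = "(\<lambda>p. 1 # 1 # p) ` above_once 2" and ?B = "(\<lambda>p. 1 # 1 # 2 # p) ` above 3"
  have A: "length_gf ?A N = (if N < 2 then 0 else Q ^ (2 * N - 2) * length_gf (above_once 0) (N - 2))"
  proof (cases "N < 2")
    case False
    have "length_gf ?A (N - 2 + 2) = Q ^ 2 * length_gf (above_once 2) (N - 2)"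
      by (rule length_gf_image) (auto simp: inj_on_def)
    also have "\<dots> = Q ^ (2 + 2 * (N - 2)) * length_gf (above_once 0) (N - 2)"
      by (simp only: shift_once[of 2] power_add mult.assoc)
    also have "N - 2 + 2 = N" using False by simp
    also have "2 + 2 * (N - 2) = 2 * N - 2" using False by simp
    finally show ?thesis using False by (simp only: if_False)
  qed (auto intro!: length_gf_eq_0)
  have B: "length_gf ?B N = (if N < 3 then 0 else Q ^ (3 * N - 5) * length_gf (above 0) (N - 3))"
  proof (cases "N < 3")
    case False
    have "length_gf ?B (N - 3 + 3) = Q ^ 4 * length_gf (above 3) (N - 3)"
      by (rule length_gf_image) (auto simp: inj_on_def)
    also have "\<dots> = Q ^ (4 + 3 * (N - 3)) * length_gf (above 0) (N - 3)"
      by (simp only: shift_above[of 3] power_add mult.assoc)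
    also have "N - 3 + 3 = N" using False by simp
    also have "4 + 3 * (N - 3) = 3 * N - 5" using False by simp
    finally show ?thesis using False by (simp only: if_False)
  qed (auto intro!: length_gf_eq_0)
  have "?A \<inter> ?B = {}" by (auto simp: above_once_iff above_Cons_iff)
  moreover have "above_once 0 \<inter> (?A \<union> ?B) = {}" by (auto simp: above_once_iff)
  ultimately have "length_gf (above_once 0 \<union> (?A \<union> ?B)) N =
      length_gf (above_once 0) N + (length_gf ?A N + length_gf ?B N)"
    by (simp only: length_gf_Un)
  then show "length_gf (above 0) N = length_gf (above_once 0) N +
      (if N < 2 then 0 else Q ^ (2 * N - 2) * length_gf (above_once 0) (N - 2)) +
      (if N < 3 then 0 else Q ^ (3 * N - 5) * length_gf (above 0) (N - 3))"
    by (simp only: A B above_0_eq[symmetric] add.assoc)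
qed

section \<open>The product form of the triple sum\<close>

text \<open>This replaces division: \<open>xq_series\<close> is not a field, so equations between
  inverses come from a common factor.\<close>

lemma mult_right_inverse_unique:
  fixes a b c :: "'a::comm_monoid_mult"
  assumes "a * b = 1" "a * c = 1"
  shows "b = c"
proof -
  have "b = b * (a * c)" using assms by simp
  also have "\<dots> = a * b * c" by (simp only: mult_ac)
  finally show ?thesis using assms by simp
qed

definition inv_qpoch :: "nat \<Rightarrow> nat \<Rightarrow> xq_series" where
  "inv_qpoch m n = inverse (qpoch (Q ^ m) (Q ^ m) n)"

lemma inv_qpoch_0: "inv_qpoch m 0 = 1"
  by (simp add: inv_qpoch_def qpoch_def fps_inverse_one')

lemma inv_qpoch_Suc:
  assumes "m > 0"
  shows "(1 - Q ^ (m * Suc n)) * inv_qpoch m (Suc n) = inv_qpoch m n"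
proof -
  let ?p = "\<lambda>n. qpoch (Q ^ m) (Q ^ m) n"
  have "?p (Suc n) = (1 - Q ^ (m * Suc n)) * ?p n"
    by (simp add: qpoch_def power_add power_mult mult.commute)
  moreover have "?p (Suc n) * inv_qpoch m (Suc n) = 1" "?p n * inv_qpoch m n = 1"
    using assms qpoch_mult_inverse unfolding inv_qpoch_def by blast+
  ultimately have "?p n * ((1 - Q ^ (m * Suc n)) * inv_qpoch m (Suc n)) = 1" "?p n * inv_qpoch m n = 1"
    by (simp_all only: mult_ac)
  then show ?thesis by (rule mult_right_inverse_unique)
qed

lemma inverse_denominator:
  "inverse (qpoch Q Q i * qpoch (Q ^ 2) (Q ^ 2) j * qpoch (Q ^ 3) (Q ^ 3) k) =
     inv_qpoch 1 i * inv_qpoch 2 j * inv_qpoch 3 k"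
proof -
  let ?d = "qpoch Q Q i * qpoch (Q ^ 2) (Q ^ 2) j * qpoch (Q ^ 3) (Q ^ 3) k"
  have nth_0: "fps_nth (qpoch (Q ^ m) (Q ^ m) n) 0 = 1" if "m > 0" for m n
    using that by (induction n) (auto simp: qpoch_def Q_def)
  have d_0: "fps_nth ?d 0 = 1"
    using nth_0[of 1 i] nth_0[of 2 j] nth_0[of 3 k] by simp
  then have "inverse (fps_nth ?d 0) = 1"
    by (simp add: fps_inverse_one' del: fps_mult_nth_0)
  with d_0 have inv: "?d * inverse ?d = 1"
    using fps_right_inverse[of ?d 1] unfolding fps_inverse_def[of ?d] by simp
  have "?d * (inv_qpoch 1 i * inv_qpoch 2 j * inv_qpoch 3 k) =
      (qpoch Q Q i * inv_qpoch 1 i) * (qpoch (Q ^ 2) (Q ^ 2) j * inv_qpoch 2 j) *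
      (qpoch (Q ^ 3) (Q ^ 3) k * inv_qpoch 3 k)"
    by (simp only: mult_ac)
  also have "\<dots> = 1"
    using qpoch_mult_inverse[of 1 i] qpoch_mult_inverse[of 2 j] qpoch_mult_inverse[of 3 k]
    unfolding inv_qpoch_def power_one_right by simp
  finally show ?thesis by (rule mult_right_inverse_unique[OF inv])
qed

section \<open>The dilation x -> xq and the functional equation of the product\<close>

definition q_dilate :: "xq_series fps \<Rightarrow> xq_series fps" where
  "q_dilate F = Abs_fps (\<lambda>n. Q ^ n * fps_nth F n)"

lemma q_dilate_mult: "q_dilate (F * G) = q_dilate F * q_dilate G"
proof (rule fps_ext)
  fix n
  have "Q ^ n * (\<Sum>i=0..n. fps_nth F i * fps_nth G (n - i)) =
        (\<Sum>i=0..n. (Q ^ i * fps_nth F i) * (Q ^ (n - i) * fps_nth G (n - i)))"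
    unfolding sum_distrib_left
  proof (rule sum.cong)
    fix i assume "i \<in> {0..n}"
    then have "Q ^ n = Q ^ i * Q ^ (n - i)" by (simp flip: power_add)
    then show "Q ^ n * (fps_nth F i * fps_nth G (n - i)) =
        (Q ^ i * fps_nth F i) * (Q ^ (n - i) * fps_nth G (n - i))"
      by (simp add: mult_ac)
  qed simp
  then show "fps_nth (q_dilate (F * G)) n = fps_nth (q_dilate F * q_dilate G) n"
    by (simp add: q_dilate_def fps_mult_nth)
qed

text \<open>This is the series with terms f(k) x^(mk); a unit of i, j or k carries m = 1, 2 or 3
  powers of x.\<close>

definition stretch :: "nat \<Rightarrow> (nat \<Rightarrow> xq_series) \<Rightarrow> xq_series fps" where
  "stretch m f = Abs_fps (\<lambda>n. if m dvd n then f (n div m) else 0)"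

lemma monomial_mult_nth:
  "fps_nth (fps_const c * fps_X ^ m * F) n = (if n < m then 0 else c * fps_nth F (n - m))"
  for F :: "'a::comm_ring_1 fps"
  by (simp add: mult.assoc fps_X_power_mult_nth)

text \<open>In F(x) - F(xq) the coefficient of x^(mk) is (1 - q^(mk)) f(k), which vanishes for k = 0
  and is given by the second assumption otherwise. \<open>G\<close> is left free because it is the
  series itself in two applications and its dilation in the third.\<close>

lemma stretch_shift:
  assumes "m > 0"
    and "\<And>k. (1 - Q ^ (m * Suc k)) * f (Suc k) = c * g k"
    and "stretch m g = G"
  shows "stretch m f - q_dilate (stretch m f) = fps_const c * fps_X ^ m * G"
proof (rule fps_ext)
  fix n
  show "fps_nth (stretch m f - q_dilate (stretch m f)) n = fps_nth (fps_const c * fps_X ^ m * G) n"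
  proof (cases "m dvd n")
    case True
    then obtain k where "n = m * k" by blast
    then show ?thesis
      using assms(1) assms(2)[unfolded left_diff_distrib mult_1_left]
      by (cases k) (simp_all add: monomial_mult_nth q_dilate_def stretch_def flip: assms(3))
  next
    case False
    then show ?thesis
      by (auto simp: monomial_mult_nth q_dilate_def stretch_def dvd_minus_self simp flip: assms(3))
  qed
qed

lemma q_dilate_stretch: "m > 0 \<Longrightarrow> q_dilate (stretch m f) = stretch m (\<lambda>k. Q ^ (m * k) * f k)"
  by (rule fps_ext) (auto simp: q_dilate_def stretch_def)

lemma mult_stretch_nth:
  assumes "m > 0"
  shows "fps_nth (F * stretch m f) n = (\<Sum>k | m * k \<le> n. fps_nth F (n - m * k) * f k)"
proof -
  have "fps_nth (F * stretch m f) n =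
      (\<Sum>i=0..n. fps_nth F (n - i) * (if m dvd i then f (i div m) else 0))"
    unfolding mult.commute[of F] fps_mult_nth stretch_def by (simp add: mult.commute)
  also have "\<dots> = (\<Sum>i\<in>(*) m ` {k. m * k \<le> n}.
      fps_nth F (n - i) * (if m dvd i then f (i div m) else 0))"
    by (rule sum.mono_neutral_right) (auto elim!: dvdE)
  also have "\<dots> = (\<Sum>k | m * k \<le> n. fps_nth F (n - m * k) * f k)"
    using assms by (subst sum.reindex) (auto simp: inj_on_def)
  finally show ?thesis .
qed

text \<open>
  The indeterminate of this outer series plays the role of \<open>x\<close>; its coefficients are series
  in \<open>q\<close> alone, so that the substitution \<open>x \<mapsto> xq\<close> is \<^const>\<open>q_dilate\<close>.
\<close>
definition product_gf :: "xq_series fps" where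
  "product_gf = stretch 1 (\<lambda>i. Q ^ i * inv_qpoch 1 i) *
     stretch 2 (\<lambda>j. Q ^ (j ^ 2 + 2 * j) * inv_qpoch 2 j) *
     stretch 3 (\<lambda>k. Q ^ (4 * k) * inv_qpoch 3 k)"

definition triples :: "nat \<Rightarrow> (nat \<times> nat \<times> nat) set" where
  "triples N = {(i, j, k). i + 2 * j + 3 * k = N}"

text \<open>In the Cauchy product k and j range freely and i = N - 3k - 2j is forced. The result is
  the coefficient of x^N in the triple sum without the factor q^(N(N-1)/2).\<close>

lemma product_gf_nth:
  "fps_nth product_gf N =
     (\<Sum>(i, j, k)\<in>triples N.
       Q ^ (i + j ^ 2 + 2 * j + 4 * k) * (inv_qpoch 1 i * inv_qpoch 2 j * inv_qpoch 3 k))"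
proof -
  have fin: "finite {k. m * k \<le> n}" if "m > 0" for m n :: nat
    by (rule finite_subset[of _ "{..n}"])
      (use that in \<open>auto intro: order_trans[rotated]\<close>)
  have "fps_nth product_gf N = (\<Sum>k | 3 * k \<le> N. \<Sum>j | 2 * j \<le> N - 3 * k.
      Q ^ (N - 3 * k - 2 * j) * inv_qpoch 1 (N - 3 * k - 2 * j) * (Q ^ (j ^ 2 + 2 * j) * inv_qpoch 2 j) *
      (Q ^ (4 * k) * inv_qpoch 3 k))"
    unfolding product_gf_def
    by (simp add: mult_stretch_nth sum_distrib_right) (simp add: stretch_def)
  also have "\<dots> = (\<Sum>(k, j)\<in>(SIGMA k:{k. 3 * k \<le> N}. {j. 2 * j \<le> N - 3 * k}).
      Q ^ (N - 3 * k - 2 * j) * inv_qpoch 1 (N - 3 * k - 2 * j) * (Q ^ (j ^ 2 + 2 * j) * inv_qpoch 2 j) *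
      (Q ^ (4 * k) * inv_qpoch 3 k))"
    by (rule sum.Sigma) (use fin in auto)
  also have "\<dots> = (\<Sum>(i, j, k)\<in>triples N.
       Q ^ (i + j ^ 2 + 2 * j + 4 * k) * (inv_qpoch 1 i * inv_qpoch 2 j * inv_qpoch 3 k))"
    by (rule sum.reindex_bij_witness[of _ "\<lambda>(i, j, k). (k, j)" "\<lambda>(k, j). (N - 3 * k - 2 * j, j, k)"])
      (auto simp: triples_def power_add mult_ac)
  finally show ?thesis .
qed

text \<open>By Euler, the factors \<open>U\<close>, \<open>V\<close>, \<open>W\<close> expand
  1/(xq;q), (-x^2 q^3;q^2) and 1/(x^3 q^4;q^3). Infinite products are avoided: each factor gets its
  own q-difference equation, and the three are multiplied.\<close>

lemma product_gf_functional_equation: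
  "(1 - fps_const Q * fps_X) * (1 - fps_const (Q ^ 4) * fps_X ^ 3) * product_gf =
     (1 + fps_const (Q ^ 3) * fps_X ^ 2) * q_dilate product_gf"
proof -
  define U where "U = stretch 1 (\<lambda>i. Q ^ i * inv_qpoch 1 i)"
  define V where "V = stretch 2 (\<lambda>j. Q ^ (j ^ 2 + 2 * j) * inv_qpoch 2 j)"
  define W where "W = stretch 3 (\<lambda>k. Q ^ (4 * k) * inv_qpoch 3 k)"
  have "U - q_dilate U = fps_const Q * fps_X ^ 1 * U"
    unfolding U_def
  proof (rule stretch_shift)
    fix k
    show "(1 - Q ^ (1 * Suc k)) * (Q ^ Suc k * inv_qpoch 1 (Suc k)) = Q * (Q ^ k * inv_qpoch 1 k)"
      unfolding inv_qpoch_Suc[of 1 k, OF zero_less_one, symmetric] by (simp only: power_Suc mult_ac)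
  qed simp_all
  then have U: "(1 - fps_const Q * fps_X) * U = q_dilate U"
    by (simp add: algebra_simps)
  have "W - q_dilate W = fps_const (Q ^ 4) * fps_X ^ 3 * W"
    unfolding W_def
  proof (rule stretch_shift)
    fix k
    have "Q ^ (4 * Suc k) = Q ^ 4 * Q ^ (4 * k)" by (simp add: power_add)
    then show "(1 - Q ^ (3 * Suc k)) * (Q ^ (4 * Suc k) * inv_qpoch 3 (Suc k)) =
        Q ^ 4 * (Q ^ (4 * k) * inv_qpoch 3 k)"
      unfolding inv_qpoch_Suc[of 3 k, OF zero_less_numeral, symmetric] by (simp only: mult_ac)
  qed simp_all
  then have W: "(1 - fps_const (Q ^ 4) * fps_X ^ 3) * W = q_dilate W"
    by (simp add: algebra_simps)
  have "V - q_dilate V = fps_const (Q ^ 3) * fps_X ^ 2 * q_dilate V"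
    unfolding V_def
  proof (rule stretch_shift)
    fix k
    \<comment> \<open>The exponent grows by 2k + 3, and the part q^(2k) turns \<open>V\<close> on
      the right into its dilation.\<close>
    have "Q ^ ((Suc k) ^ 2 + 2 * Suc k) = Q ^ 3 * (Q ^ (2 * k) * Q ^ (k ^ 2 + 2 * k))"
      unfolding power_add[symmetric]
      by (rule arg_cong[where f = "(^) Q"]) (simp add: power2_eq_square)
    then show "(1 - Q ^ (2 * Suc k)) * (Q ^ ((Suc k) ^ 2 + 2 * Suc k) * inv_qpoch 2 (Suc k)) =
        Q ^ 3 * (Q ^ (2 * k) * (Q ^ (k ^ 2 + 2 * k) * inv_qpoch 2 k))"
      unfolding inv_qpoch_Suc[of 2 k, OF zero_less_numeral, symmetric] by (simp only: mult_ac)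
  qed (simp_all add: q_dilate_stretch)
  then have V: "V = (1 + fps_const (Q ^ 3) * fps_X ^ 2) * q_dilate V"
    by (simp add: algebra_simps)
  have "(1 - fps_const Q * fps_X) * (1 - fps_const (Q ^ 4) * fps_X ^ 3) * (U * V * W) =
      q_dilate U * V * q_dilate W"
    by (simp flip: U W add: mult_ac)
  also have "\<dots> = (1 + fps_const (Q ^ 3) * fps_X ^ 2) * (q_dilate U * q_dilate V * q_dilate W)"
    by (subst V) (simp only: mult_ac)
  finally show ?thesis
    by (simp add: product_gf_def q_dilate_mult U_def V_def W_def)
qed

section \<open>The common recurrence\<close>

text \<open>This is the coefficient of x^N in the functional equation for P(x): a term x^s q^w
  P(xq^m) contributes the exponent w + m(N-s).\<close>

definition satisfies_rec :: "(nat \<Rightarrow> xq_series) \<Rightarrow> bool" where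
  "satisfies_rec c \<longleftrightarrow> c 0 = 1 \<and> (\<forall>N > 0. (1 - Q ^ N) * c N =
     Q ^ N * c (N - 1) + (if N < 2 then 0 else Q ^ (3 * N - 2) * c (N - 2)) +
     (if N < 3 then 0 else Q ^ (3 * N - 2) * c (N - 3)) -
     (if N < 4 then 0 else Q ^ (4 * N - 5) * c (N - 4)))"

text \<open>For N > 0 the factor 1 - q^N is nonzero in an integral domain, so earlier coefficients
  determine the next one.\<close>

lemma satisfies_rec_unique:
  assumes "satisfies_rec a" "satisfies_rec b"
  shows "a N = b N"
proof (induction N rule: less_induct)
  case (less N)
  show ?case
  proof (cases "N = 0")
    case True
    with assms show ?thesis by (simp add: satisfies_rec_def)
  next
    case False
    then have "fps_nth (1 - Q ^ N) 0 = 1" by (simp add: Q_def)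
    then have "1 - Q ^ N \<noteq> 0" by (metis fps_zero_nth zero_neq_one)
    moreover have "(1 - Q ^ N) * a N = (1 - Q ^ N) * b N"
      using assms less False by (simp add: satisfies_rec_def)
    ultimately show ?thesis by simp
  qed
qed

definition c_rhs :: "nat \<Rightarrow> xq_series" where
  "c_rhs N = Q ^ (N * (N - 1) div 2) * fps_nth product_gf N"

lemma satisfies_rec_c_rhs: "satisfies_rec c_rhs"
proof -
  define d where "d = fps_nth product_gf"
  define e where "e N = N * (N - 1) div 2" for N :: nat
  have e: "e 0 = 0" "e (Suc N) = e N + N" for N
  proof -
    have "Suc N * N = N * (N - 1) + N * 2" by (cases N) auto
    then show "e (Suc N) = e N + N" by (simp add: e_def)
  qed (simp add: e_def)
  \<comment> \<open>Here x^2 q^3 D(xq) contributes q^3 q^(N-2) = q^(N+1), and q^5 comes from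
    expanding (1 - xq)(1 - x^3 q^4).\<close>
  have d: "(1 - Q ^ N) * d N = Q * d (N - 1) + (if N < 2 then 0 else Q ^ Suc N * d (N - 2)) +
     (if N < 3 then 0 else Q ^ 4 * d (N - 3)) - (if N < 4 then 0 else Q ^ 5 * d (N - 4))"
    if "N > 0" for N
  proof -
    have "product_gf - fps_const Q * fps_X ^ 1 * product_gf -
            fps_const (Q ^ 4) * fps_X ^ 3 * product_gf + fps_const (Q ^ 5) * fps_X ^ 4 * product_gf =
          q_dilate product_gf + fps_const (Q ^ 3) * fps_X ^ 2 * q_dilate product_gf"
      using product_gf_functional_equation
      by (simp add: algebra_simps eval_nat_numeral flip: fps_const_mult)
    from arg_cong[OF this, of "\<lambda>F. fps_nth F N"]
    show ?thesis using that
      unfolding fps_add_nth fps_sub_nth monomial_mult_nth d_def q_dilate_def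
      by (auto simp: algebra_simps simp flip: power_add power_Suc split: if_splits)
  qed
  have "(1 - Q ^ N) * c_rhs N =
     Q ^ N * c_rhs (N - 1) + (if N < 2 then 0 else Q ^ (3 * N - 2) * c_rhs (N - 2)) +
     (if N < 3 then 0 else Q ^ (3 * N - 2) * c_rhs (N - 3)) -
     (if N < 4 then 0 else Q ^ (4 * N - 5) * c_rhs (N - 4))" if N: "N > 0" for N
  proof -
    have c: "c_rhs n = Q ^ e n * d n" for n by (simp add: c_rhs_def e_def d_def)
    have 1: "Q ^ e N * Q = Q ^ N * Q ^ e (N - 1)"
      using N by (cases N) (simp_all add: e power_add mult_ac)
    \<comment> \<open>These differences of triangular numbers carry the exponents N+1, 4, 5 of the
      recurrence for \<open>d\<close> to 3N-2, 3N-2, 4N-5. Writing N = s + n avoids truncated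
      subtraction.\<close>
    have e': "e (2 + n) = e n + 2 * n + 1" "e (3 + n) = e n + 3 * n + 3" "e (4 + n) = e n + 4 * n + 6" for n
      by (simp_all add: e eval_nat_numeral)
    have 2: "Q ^ e N * Q ^ Suc N = Q ^ (3 * N - 2) * Q ^ e (N - 2)" if "\<not> N < 2"
    proof -
      from that have "2 \<le> N" by simp
      then obtain n where "N = 2 + n" using le_Suc_ex by blast
      then have "e N + Suc N = 3 * N - 2 + e (N - 2)" by (simp only: e') simp
      then show ?thesis by (simp only: power_add[symmetric])
    qed
    have 3: "Q ^ e N * Q ^ 4 = Q ^ (3 * N - 2) * Q ^ e (N - 3)" if "\<not> N < 3"
    proof -
      from that have "3 \<le> N" by simp
      then obtain n where "N = 3 + n" using le_Suc_ex by blast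
      then have "e N + 4 = 3 * N - 2 + e (N - 3)" by (simp only: e') simp
      then show ?thesis by (simp only: power_add[symmetric])
    qed
    have 4: "Q ^ e N * Q ^ 5 = Q ^ (4 * N - 5) * Q ^ e (N - 4)" if "\<not> N < 4"
    proof -
      from that have "4 \<le> N" by simp
      then obtain n where "N = 4 + n" using le_Suc_ex by blast
      then have "e N + 5 = 4 * N - 5 + e (N - 4)" by (simp only: e') simp
      then show ?thesis by (simp only: power_add[symmetric])
    qed
    have "(1 - Q ^ N) * c_rhs N = Q ^ e N * ((1 - Q ^ N) * d N)" by (simp add: c mult_ac)
    also have "\<dots> = Q ^ e N * Q * d (N - 1) + (if N < 2 then 0 else Q ^ e N * Q ^ Suc N * d (N - 2)) +
     (if N < 3 then 0 else Q ^ e N * Q ^ 4 * d (N - 3)) - (if N < 4 then 0 else Q ^ e N * Q ^ 5 * d (N - 4))"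
      unfolding d[OF N] by (simp add: algebra_simps)
    also have "\<dots> = Q ^ N * Q ^ e (N - 1) * d (N - 1) +
       (if N < 2 then 0 else Q ^ (3 * N - 2) * Q ^ e (N - 2) * d (N - 2)) +
       (if N < 3 then 0 else Q ^ (3 * N - 2) * Q ^ e (N - 3) * d (N - 3)) -
       (if N < 4 then 0 else Q ^ (4 * N - 5) * Q ^ e (N - 4) * d (N - 4))"
      by (simp only: 1 2 3 4 not_False_eq_True cong: if_cong)
    finally show ?thesis
      by (simp only: c mult.assoc)
  qed
  moreover have "c_rhs 0 = 1"
  proof -
    have "triples 0 = {(0, 0, 0)}" by (auto simp: triples_def)
    then show ?thesis by (simp add: c_rhs_def product_gf_nth inv_qpoch_0)
  qed
  ultimately show ?thesis unfolding satisfies_rec_def by blast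
qed

text \<open>The auxiliary \<open>r\<close> is eliminated from the system: \<open>t\<close> at N
  brings in r(N), whose expansion leaves only r(N-3), and the same relation at N-3 expresses q^(N-3)
  r(N-3) through \<open>t\<close>.\<close>

lemma satisfies_rec_length_gf: "satisfies_rec (length_gf (above_once 0))"
  unfolding satisfies_rec_def
proof (intro conjI allI impI)
  show "length_gf (above_once 0) 0 = 1" by (rule length_gf_above_once_0)
next
  fix N :: nat assume N: "N > 0"
  define t where "t = length_gf (above_once 0)"
  define r where "r = length_gf (above 0)"
  have t: "t n = Q ^ n * r n + Q ^ n * t (n - 1)" if "n > 0" for n
    using length_gf_above_once_Suc[of "n - 1"] that by (simp add: t_def r_def)
  \<comment> \<open>At n = 0 there is no predecessor; there the equation for \<open>above 0\<close>
    gives r(0) = t(0).\<close>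
  have r: "Q ^ n * r n = t n - (if n = 0 then 0 else Q ^ n * t (n - 1))" for n
    using t[of n] length_gf_above[of 0] by (cases "n = 0") (simp_all add: t_def r_def)
  define t2 where "t2 = (if N < 2 then 0 else Q ^ (2 * N - 2) * t (N - 2))"
  define r3 where "r3 = (if N < 3 then 0 else Q ^ (3 * N - 5) * r (N - 3))"
  have "r N = t N + t2 + r3"
    unfolding r_def t_def t2_def r3_def by (rule length_gf_above)
  with t[OF N] have "t N = Q ^ N * (t N + t2 + r3) + Q ^ N * t (N - 1)"
    by simp
  then have "(1 - Q ^ N) * t N = Q ^ N * t (N - 1) + Q ^ N * t2 + Q ^ N * r3"
    by (simp add: algebra_simps)
  also have "Q ^ N * t2 = (if N < 2 then 0 else Q ^ (3 * N - 2) * t (N - 2))"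
  proof (cases "N < 2")
    case False
    then have "3 * N - 2 = N + (2 * N - 2)" by simp
    with False show ?thesis by (simp only: t2_def if_False power_add mult.assoc)
  qed (simp add: t2_def)
  also have "Q ^ N * r3 = (if N < 3 then 0 else Q ^ (3 * N - 2) * t (N - 3)) -
      (if N < 4 then 0 else Q ^ (4 * N - 5) * t (N - 4))"
  proof (cases "N < 3")
    case False
    \<comment> \<open>Regrouping the exponent isolates the factor q^(N-3) with which r(N-3) can be
      replaced.\<close>
    then have "N + (3 * N - 5) = (3 * N - 2) + (N - 3)" by simp
    then have "Q ^ N * (Q ^ (3 * N - 5) * r (N - 3)) = Q ^ (3 * N - 2) * (Q ^ (N - 3) * r (N - 3))"
      by (simp only: mult.assoc[symmetric] power_add[symmetric])
    then have *: "Q ^ N * r3 = Q ^ (3 * N - 2) *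
        (t (N - 3) - (if N - 3 = 0 then 0 else Q ^ (N - 3) * t (N - 3 - 1)))"
      using False by (simp only: r3_def if_False r)
    show ?thesis
    proof (cases "N = 3")
      case True
      with * show ?thesis by simp
    next
      case N_neq_3: False
      with False have "4 * N - 5 = (3 * N - 2) + (N - 3)" "N - 3 - 1 = N - 4" "N - 3 \<noteq> 0" "\<not> N < 4"
        by simp_all
      with False show ?thesis
        unfolding * by (simp only: if_False power_add mult.assoc right_diff_distrib)
    qed
  qed (simp add: r3_def)
  finally show "(1 - Q ^ N) * length_gf (above_once 0) N =
     Q ^ N * length_gf (above_once 0) (N - 1) +
     (if N < 2 then 0 else Q ^ (3 * N - 2) * length_gf (above_once 0) (N - 2)) +
     (if N < 3 then 0 else Q ^ (3 * N - 2) * length_gf (above_once 0) (N - 3)) -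
     (if N < 4 then 0 else Q ^ (4 * N - 5) * length_gf (above_once 0) (N - 4))"
    by (simp only: t_def add_diff_eq)
qed

section \<open>Summability of both sides and grouping by powers of x\<close>

lemma X_power_mult_nth: "fps_nth (X ^ N * F) n = fps_X ^ N * fps_nth F n"
  by (simp add: X_def fps_const_power)

text \<open>Parts are positive, so the length is at most the sum. Hence only finitely many
  partitions, all of length N <= n, reach the coefficient of q^n.\<close>

lemma has_sum_lhs:
  "(lhs_term has_sum Abs_fps (\<lambda>n. \<Sum>N\<le>n. fps_nth (X ^ N * length_gf P_set N) n)) P_set"
proof -
  have length_le: "length p \<le> sum_list p" if "p \<in> P_set" for p
  proof -
    have "\<forall>a\<in>set p. 0 < a" using that by (simp add: P_set_def is_partition_def)
    then show ?thesis by (induction p) auto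
  qed
  have fin: "finite {p \<in> P_set. sum_list p \<le> n}" for n
    by (rule finite_subset[OF _ finite_lists_length_le[of "{..n}" n]])
      (auto dest: member_le_sum_list length_le)
  have nth: "fps_nth (lhs_term p) n = (if sum_list p = n then fps_X ^ length p else 0)" for p n
    by (simp add: lhs_term_def X_power_mult_nth Q_def)
  have "(\<Sum>p | p \<in> P_set \<and> sum_list p \<le> n. fps_nth (lhs_term p) n) =
      (\<Sum>N\<le>n. fps_nth (X ^ N * length_gf P_set N) n)" for n
  proof -
    have "(\<Sum>p | p \<in> P_set \<and> sum_list p \<le> n. fps_nth (lhs_term p) n) =
        (\<Sum>N\<le>n. \<Sum>p | p \<in> {p \<in> P_set. sum_list p \<le> n} \<and> length p = N. fps_nth (lhs_term p) n)"
      by (rule sum.group[symmetric]) (use fin length_le in \<open>auto intro: order_trans\<close>)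
    also have "\<dots> = (\<Sum>N\<le>n. \<Sum>p | p \<in> P_set \<and> length p = N \<and> sum_list p = n. fps_X ^ N)"
      by (intro sum.cong refl sum.mono_neutral_cong_right)
        (auto simp: nth intro: finite_subset[OF _ fin[of n]])
    also have "\<dots> = (\<Sum>N\<le>n. fps_nth (X ^ N * length_gf P_set N) n)"
      by (simp add: X_power_mult_nth length_gf_def mult.commute)
    finally show ?thesis .
  qed
  then show ?thesis
    using has_sum_fps[of P_set sum_list lhs_term, OF fin] by (simp add: nth)
qed

lemma rhs_term_eq:
  assumes "i + 2 * j + 3 * k = N"
  shows "rhs_term i j k =
    X ^ N * (Q ^ (N * (N - 1) div 2) * (Q ^ (i + j ^ 2 + 2 * j + 4 * k) *
      (inv_qpoch 1 i * inv_qpoch 2 j * inv_qpoch 3 k)))"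
  unfolding rhs_term_def Let_def inverse_denominator assms by (simp only: power_add mult.assoc)

text \<open>The power of q in a term is at least N = i + 2j + 3k, so \<open>size\<close> serves as
  the weight and only N <= n matters for q^n. Grouping by N gives the same shape as on the partition
  side.\<close>

lemma has_sum_rhs:
  "((\<lambda>(i, j, k). rhs_term i j k) has_sum Abs_fps (\<lambda>n. \<Sum>N\<le>n. fps_nth (X ^ N * c_rhs N) n)) UNIV"
proof -
  define size where "size = (\<lambda>(i, j, k). i + 2 * j + 3 * k :: nat)"
  define f where "f = (\<lambda>(i, j, k). rhs_term i j k)"
  have fin: "finite {s \<in> UNIV. size s \<le> n}" for n
    by (rule finite_subset[of _ "{..n} \<times> {..n} \<times> {..n}"]) (auto simp: size_def)
  have zero: "fps_nth (f s) n = 0" if n: "n < size s" for s n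
  proof -
    obtain i j k where s: "s = (i, j, k)" by (cases s)
    define F where "F = X ^ size s * inverse (qpoch Q Q i * qpoch (Q ^ 2) (Q ^ 2) j * qpoch (Q ^ 3) (Q ^ 3) k)"
    define e where "e = size s * (size s - 1) div 2 + i + j ^ 2 + 2 * j + 4 * k"
    have "f s = Q ^ e * F"
      by (simp add: s f_def size_def rhs_term_def Let_def F_def e_def mult_ac)
    moreover have "n < e"
      using n by (simp add: e_def) (simp add: size_def s)
    ultimately show ?thesis by (simp add: Q_def fps_X_power_mult_nth)
  qed
  have "(\<Sum>s | s \<in> UNIV \<and> size s \<le> n. fps_nth (f s) n) =
      (\<Sum>N\<le>n. fps_nth (X ^ N * c_rhs N) n)" for n
  proof -
    have triples_sum: "(\<Sum>s\<in>triples N. f s) = X ^ N * c_rhs N" for N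
      unfolding c_rhs_def product_gf_nth sum_distrib_left
      by (rule sum.cong) (auto simp only: f_def triples_def rhs_term_eq mem_Collect_eq prod.case)
    have "(\<Sum>s | s \<in> UNIV \<and> size s \<le> n. fps_nth (f s) n) =
        (\<Sum>N\<le>n. \<Sum>s | s \<in> {s \<in> UNIV. size s \<le> n} \<and> size s = N. fps_nth (f s) n)"
      by (rule sum.group[symmetric]) (use fin in auto)
    also have "\<dots> = (\<Sum>N\<le>n. \<Sum>s\<in>triples N. fps_nth (f s) n)"
      by (intro sum.cong refl) (auto simp: triples_def size_def)
    also have "\<dots> = (\<Sum>N\<le>n. fps_nth (X ^ N * c_rhs N) n)"
      by (simp only: fps_sum_nth[symmetric] triples_sum)
    finally show ?thesis .
  qed
  then show ?thesis
    using has_sum_fps[of UNIV size f, OF fin zero] by (simp add: f_def)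
qed

theorem mainTheorem6:
  shows "lhs_term summable_on P_set \<and>
         (\<lambda>(i, j, k). rhs_term i j k) summable_on UNIV \<and>
         (\<Sum>\<^sub>\<infinity>p\<in>P_set. lhs_term p) = (\<Sum>\<^sub>\<infinity>(i, j, k)\<in>UNIV. rhs_term i j k)"
proof -
  have "length_gf P_set N = c_rhs N" for N
    unfolding P_set_eq_above_once by (rule satisfies_rec_unique[OF satisfies_rec_length_gf satisfies_rec_c_rhs])
  then have "(lhs_term has_sum Abs_fps (\<lambda>n. \<Sum>N\<le>n. fps_nth (X ^ N * c_rhs N) n)) P_set"
    using has_sum_lhs by simp
  with has_sum_rhs show ?thesis
    by (auto simp: infsumI has_sum_imp_summable)
qed

end
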